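(* There is an absolute constant $C>0$ such that for every integer $n \geq 2$ and every $\alpha \in [0,1]$, if $\mathcal{A}$ is a random set in $\mathcal{B}(n,\alpha)$ and $X := \deg \operatorname{lcm}\big([\mathcal{A}]_q\big)$, then \[ \left| \mathbb{E}[X] - \frac{3}{\pi^2}\cdot \frac{\alpha\, \mathrm{Li}_2(1-\alpha)}{1-\alpha}\cdot n^2 \right| \leq C\, \alpha n (\log n)^2 , \] where $\mathrm{Li}_2(z) := \sum_{k=1}^\infty z^k/k^2$ is the dilogarithm and the factor $\frac{\alpha\, \mathrm{Li}_2(1-\alpha)}{1-\alpha}$ is interpreted as $1$ when $\alpha = 1$. In particular, $\mathbb{E}[X] \sim \frac{3}{\pi^2}\cdot \frac{\alpha\, \mathrm{Li}_2(1-\alpha)}{1-\alpha}\cdot n^2$ as $n \to +\infty$, uniformly for $\alpha \in (0,1]$.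
   Context: For a positive integer $n$ and $\alpha\in[0,1]$, $\mathcal{B}(n,\alpha)$ denotes the probabilistic model in which a random set $\mathcal{A}\subseteq\{1,\dots,n\}$ is constructed by including each element of $\{1,\dots,n\}$ independently with probability $\alpha$. For an indeterminate $q$ and a positive integer $k$, $[k]_q := 1+q+\cdots+q^{k-1}\in\mathbb{Z}[q]$, and for a set $\mathcal{S}$ of positive integers $[\mathcal{S}]_q := \{[k]_q : k\in\mathcal{S}\}$. The least common multiple is taken in $\mathbb{Q}[q]$ (monic), with $\operatorname{lcm}(\varnothing)=1$ of degree $0$. *)

theory Defs
  imports "HOL-Analysis.Analysis" "HOL-Computational_Algebra.Computational_Algebra" "HOL-Computational_Algebra.Field_as_Ring"
begin

definition qint :: "nat \<Rightarrow> rat poly" where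
  "qint k = (\<Sum>i<k. monom 1 i)"

text \<open>X(A) = deg lcm([A]_q); Lcm of polynomials over a field is normalized (monic),
  and Lcm {} = 1.\<close>
definition lcm_deg :: "nat set \<Rightarrow> nat" where
  "lcm_deg A = degree (Lcm (qint ` A))"

text \<open>Expectation of f(A) for A drawn from B(n,alpha): each element of {1..n}
  included independently with probability alpha.\<close>
definition expect_B :: "nat \<Rightarrow> real \<Rightarrow> (nat set \<Rightarrow> real) \<Rightarrow> real" where
  "expect_B n \<alpha> f =
     (\<Sum>A\<in>Pow {1..n}. \<alpha> ^ card A * (1 - \<alpha>) ^ (n - card A) * f A)"

definition Li2 :: "real \<Rightarrow> real" where
  "Li2 z = (\<Sum>k. z ^ Suc k / (real (Suc k))^2)"

definition lcm_factor :: "real \<Rightarrow> real" where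
  "lcm_factor \<alpha> = (if \<alpha> = 1 then 1 else \<alpha> * Li2 (1 - \<alpha>) / (1 - \<alpha>))"

definition main_term :: "nat \<Rightarrow> real \<Rightarrow> real" where
  "main_term n \<alpha> = 3 / pi^2 * lcm_factor \<alpha> * (real n)^2"

end

theory Submission
  imports Defs "HOL-Number_Theory.Totient" "HOL-Real_Asymp.Real_Asymp"
begin

text \<open>
  The complex roots of the least common multiple of the \<open>[a]\<^sub>q\<close> with \<open>a \<in> A\<close> are simple, and they
  are the roots of unity of order \<open>d > 1\<close> with \<open>d\<close> dividing some element of \<open>A\<close>. Hence its degree is
  the sum of \<open>totient d\<close> over these \<open>d\<close>, and its expectation is the sum over \<open>1 < d \<le> n\<close> of
  \<open>totient d * (1 - \<beta> ^ (n div d))\<close>, where \<open>\<beta> = 1 - \<alpha>\<close>. Expanding \<open>1 - \<beta> ^ m\<close> as \<open>\<alpha>\<close> times a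
  geometric sum and exchanging summations turns this into \<open>\<alpha>\<close> times the sum over \<open>k \<le> n\<close> of
  \<open>\<beta> ^ (k - 1) * \<Phi> (n div k)\<close>, up to \<open>O(\<alpha> n)\<close>, where \<open>\<Phi>\<close> is the summatory totient. Inserting
  \<open>\<Phi> N = 3 / pi\<^sup>2 * N\<^sup>2 + O(N log N)\<close> produces the dilogarithm series. The ratio form follows because
  the main term is at least \<open>3 / pi\<^sup>2 * \<alpha> * n\<^sup>2\<close>.
\<close>

subsection \<open>Mean value of the totient function\<close>

definition moebius_mu :: "nat \<Rightarrow> real" where
  "moebius_mu n = (if squarefree n then (-1) ^ card (prime_factors n) else 0)"

lemma abs_moebius_le_1: "\<bar>moebius_mu n\<bar> \<le> 1"
  by (simp add: moebius_mu_def)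

lemma prime_factors_Prod_primes:
  fixes S :: "nat set"
  assumes "finite S" "\<And>p. p \<in> S \<Longrightarrow> prime p"
  shows "prime_factors (\<Prod>S) = S"
proof -
  have "0 \<notin> S" using assms(2) not_prime_0 by blast
  then show ?thesis
    using assms by (subst prime_factors_prod) (auto simp: prime_prime_factors)
qed

text \<open>A squarefree number is the product of its set of primes, so \<open>\<Prod>\<close> and
  \<open>prime_factors\<close> are mutually inverse here.\<close>

lemma bij_betw_Prod_squarefree_divisors:
  fixes n :: nat
  assumes "n > 0"
  shows "bij_betw \<Prod> (Pow (prime_factors n)) {d. d dvd n \<and> squarefree d}"
proof (rule bij_betw_byWitness[where f' = prime_factors])
  show "\<forall>S\<in>Pow (prime_factors n). prime_factors (\<Prod>S) = S"
    by (auto intro!: prime_factors_Prod_primes intro: finite_subset)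
  have sq: "\<Prod>(prime_factors d) = d" if "squarefree d" for d :: nat
  proof -
    have d0: "d \<noteq> 0" using that by (intro notI) auto
    have "d = (\<Prod>p\<in>prime_factors d. p ^ multiplicity p d)"
      using d0 by (simp add: prod_prime_factors)
    also have "\<dots> = \<Prod>(prime_factors d)"
      using squarefree_factorial_semiring'[OF d0] that by (intro prod.cong) auto
    finally show ?thesis by simp
  qed
  show "\<forall>d\<in>{d. d dvd n \<and> squarefree d}. \<Prod>(prime_factors d) = d" using sq by auto
  show "\<Prod> ` Pow (prime_factors n) \<subseteq> {d. d dvd n \<and> squarefree d}"
  proof safe
    fix S assume S: "S \<subseteq> prime_factors n"
    have "\<Prod>S dvd (\<Prod>p\<in>prime_factors n. p ^ multiplicity p n)"
    proof (rule prod_dvd_prod_subset2)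
      fix p assume "p \<in> S"
      then have "multiplicity p n > 0" using S by (auto simp: prime_factors_multiplicity)
      then show "p dvd p ^ multiplicity p n" by (simp add: dvd_power)
    qed (use S in auto)
    then show "\<Prod>S dvd n" using assms by (simp add: prod_prime_factors)
    show "squarefree (\<Prod>S)"
      using S by (intro squarefree_prod_coprime) (auto intro!: primes_coprime squarefree_prime)
  qed
  show "prime_factors ` {d. d dvd n \<and> squarefree d} \<subseteq> Pow (prime_factors n)"
    using assms by (auto simp: in_prime_factors_iff)
qed

text \<open>Only squarefree divisors contribute. They correspond to the subsets of the set of prime
  factors, and the signed sum over subsets is the expansion of a product of factors -1 + 1.\<close>

lemma sum_moebius_divisors:
  assumes "n > 0"
  shows "(\<Sum>d | d dvd n. moebius_mu d) = (if n = 1 then 1 else 0)"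
proof -
  note bij = bij_betw_Prod_squarefree_divisors[OF assms]
  have "(\<Sum>d | d dvd n. moebius_mu d) = (\<Sum>d | d dvd n \<and> squarefree d. (-1) ^ card (prime_factors d))"
    using assms by (intro sum.mono_neutral_cong_right) (auto simp: moebius_mu_def)
  also have "\<dots> = (\<Sum>S\<in>Pow (prime_factors n). (-1) ^ card (prime_factors (\<Prod>S)))"
    by (rule sum.reindex_bij_betw[OF bij, symmetric])
  also have "\<dots> = (\<Sum>S\<in>Pow (prime_factors n). (\<Prod>x\<in>S. -1) * (\<Prod>x\<in>prime_factors n - S. 1))"
    by (intro sum.cong refl, subst prime_factors_Prod_primes) (auto intro: finite_subset)
  also have "\<dots> = (\<Prod>x\<in>prime_factors n. -1 + 1)"
    by (rule prod_add[symmetric]) simp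
  also have "\<dots> = (if prime_factors n = {} then 1 else 0)"
    by (simp add: card_gt_0_iff)
  also have "prime_factors n = {} \<longleftrightarrow> n = 1"
    using assms by (auto simp: prime_factorization_empty_iff)
  finally show ?thesis .
qed

text \<open>Both sides run over the pairs with d * k \<le> N; the right-hand side groups them by the
  product m = d * k.\<close>

lemma sum_hyperbola:
  fixes f :: "nat \<Rightarrow> nat \<Rightarrow> 'a :: comm_monoid_add"
  shows "(\<Sum>d=1..N. \<Sum>k=1..N div d. f d k) = (\<Sum>m=1..N. \<Sum>d | d dvd m. f d (m div d))"
proof -
  have "(\<Sum>d=1..N. \<Sum>k=1..N div d. f d k) = (\<Sum>(d,k)\<in>Sigma {1..N} (\<lambda>d. {1..N div d}). f d k)"
    by (rule sum.Sigma) auto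
  also have "\<dots> = (\<Sum>(m,d)\<in>Sigma {1..N} (\<lambda>m. {d. d dvd m}). f d (m div d))"
  proof (rule sum.reindex_bij_witness[where i = "\<lambda>(m,d). (d, m div d)" and j = "\<lambda>(d,k). (d*k,d)"], goal_cases)
    case (2 a)
    then show ?case
      by (auto simp: Suc_le_eq less_eq_div_iff_mult_less_eq mult.commute)
  next
    case (4 b)
    then show ?case
      by (auto simp: Suc_le_eq div_le_mono dvd_div_eq_0_iff dvd_imp_le div_greater_zero_iff
               intro: dvd_pos_nat order.trans[OF dvd_imp_le])
  qed auto
  also have "\<dots> = (\<Sum>m=1..N. \<Sum>d | d dvd m. f d (m div d))"
    by (rule sum.Sigma[symmetric]) auto
  finally show ?thesis .
qed

section \<open>Summatory totient function and Moebius inversion\<close>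

definition totient_sum :: "nat \<Rightarrow> real" where
  "totient_sum N = (\<Sum>d=1..N. real (totient d))"

text \<open>Grouping by m leaves the totients of all divisors of m, whose sum is m.\<close>

lemma sum_totient_sum_div:
  "(\<Sum>d=1..N. totient_sum (N div d)) = real N * (real N + 1) / 2"
proof -
  have "(\<Sum>d=1..N. totient_sum (N div d)) = (\<Sum>m=1..N. \<Sum>d | d dvd m. real (totient (m div d)))"
    unfolding totient_sum_def by (rule sum_hyperbola)
  also have "\<dots> = (\<Sum>m=1..N. real m)"
  proof (rule sum.cong[OF refl])
    fix m assume m: "m \<in> {1..N}"
    have "(\<Sum>d | d dvd m. real (totient (m div d))) = (\<Sum>d | d dvd m. real (totient d))"
      by (rule sum.reindex_bij_witness[where i = "\<lambda>d. m div d" and j = "\<lambda>d. m div d"]) (use m in auto)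
    also have "\<dots> = real m"
      by (simp flip: of_nat_sum add: totient_divisor_sum)
    finally show "(\<Sum>d | d dvd m. real (totient (m div d))) = real m" .
  qed
  also have "\<dots> = real N * (real N + 1) / 2"
    by (induction N) (auto simp: field_simps)
  finally show ?thesis .
qed

text \<open>The inner Moebius sum vanishes unless m = 1. The weight \<open>g\<close> serves both the
  inversion of the summatory totient and the truncated inverse of zeta(2).\<close>

lemma sum_moebius_divisors_mult:
  assumes "N \<ge> 1"
  shows "(\<Sum>m=1..N. \<Sum>d | d dvd m. moebius_mu d * g m) = g 1"
proof -
  have "(\<Sum>m=1..N. \<Sum>d | d dvd m. moebius_mu d * g m) = (\<Sum>m=1..N. if m = 1 then g m else 0)"
    by (intro sum.cong) (auto simp: sum_moebius_divisors simp flip: sum_distrib_right)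
  then show ?thesis using assms by simp
qed

text \<open>Moebius inversion of \<open>sum_totient_sum_div\<close>: that identity is inserted at N
  div d, and the terms with equal product d * k = m collapse.\<close>

lemma totient_sum_moebius:
  assumes "N \<ge> 1"
  shows "totient_sum N = (\<Sum>d=1..N. moebius_mu d * (real (N div d) * (real (N div d) + 1) / 2))"
proof -
  have "(\<Sum>d=1..N. moebius_mu d * (real (N div d) * (real (N div d) + 1) / 2))
      = (\<Sum>d=1..N. \<Sum>k=1..N div d. moebius_mu d * totient_sum (N div (d * k)))"
    by (simp add: sum_totient_sum_div[symmetric] sum_distrib_left div_mult2_eq)
  also have "\<dots> = (\<Sum>m=1..N. \<Sum>d | d dvd m. moebius_mu d * totient_sum (N div (d * (m div d))))"
    by (rule sum_hyperbola)
  also have "\<dots> = (\<Sum>m=1..N. \<Sum>d | d dvd m. moebius_mu d * totient_sum (N div m))"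
    by (intro sum.cong) auto
  also have "\<dots> = totient_sum N"
    using assms by (simp only: sum_moebius_divisors_mult div_by_1)
  finally show ?thesis by simp
qed

text \<open>The same collapse with weight 1 / m^2; a finite form of zeta(2) times the Moebius series
  being 1.\<close>

lemma sum_moebius_inverse_squares:
  assumes "N \<ge> 1"
  shows "(\<Sum>d=1..N. moebius_mu d / real d ^ 2 * (\<Sum>k=1..N div d. 1 / real k ^ 2)) = 1"
proof -
  have "(\<Sum>d=1..N. moebius_mu d / real d ^ 2 * (\<Sum>k=1..N div d. 1 / real k ^ 2))
     = (\<Sum>d=1..N. \<Sum>k=1..N div d. moebius_mu d * (1 / real (d * k) ^ 2))"
    by (simp add: sum_distrib_left power_mult_distrib)
  also have "\<dots> = (\<Sum>m=1..N. \<Sum>d | d dvd m. moebius_mu d * (1 / real (d * (m div d)) ^ 2))"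
    by (rule sum_hyperbola)
  also have "\<dots> = (\<Sum>m=1..N. \<Sum>d | d dvd m. moebius_mu d * (1 / real m ^ 2))"
    by (intro sum.cong) auto
  also have "\<dots> = 1"
    by (subst sum_moebius_divisors_mult[OF assms]) simp
  finally show ?thesis .
qed

text \<open>The tail is dominated by the telescoping differences 1 / (k + M) - 1 / (k + M + 1).
  Constant weights give zeta(2), and the weights (1 - \<alpha>)^k give the dilogarithm. The series
  starts at 0 and the finite sum at 1, hence the shifted weight \<open>c (k - 1)\<close>.\<close>

lemma weighted_inverse_squares_tail:
  fixes c :: "nat \<Rightarrow> real"
  assumes c: "\<And>k. 0 \<le> c k" "\<And>k. c k \<le> 1" and M: "M > 0"
  shows "summable (\<lambda>k. c k / real (Suc k) ^ 2)"
    and "0 \<le> (\<Sum>k. c k / real (Suc k) ^ 2) - (\<Sum>k=1..M. c (k - 1) / real k ^ 2)"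
    and "(\<Sum>k. c k / real (Suc k) ^ 2) - (\<Sum>k=1..M. c (k - 1) / real k ^ 2) \<le> 1 / real M"
proof -
  let ?f = "\<lambda>k. c k / real (Suc k) ^ 2"
  have "summable (\<lambda>k. 1 / real (Suc k) ^ 2)"
    using inverse_squares_sums by (simp add: sums_iff add.commute)
  then show sf: "summable ?f"
    by (rule summable_comparison_test_ev[rotated]) (auto intro!: divide_right_mono c always_eventually simp: c)
  have part: "(\<Sum>k=1..M. c (k - 1) / real k ^ 2) = (\<Sum>k<M. ?f k)"
    by (rule sum.reindex_bij_witness[where i = Suc and j = "\<lambda>k. k - 1"]) auto
  have eq: "(\<Sum>k. ?f k) - (\<Sum>k=1..M. c (k - 1) / real k ^ 2) = (\<Sum>k. ?f (k + M))"
    unfolding part using suminf_minus_initial_segment[OF sf, of M] by simp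
  have sf': "summable (\<lambda>k. ?f (k + M))"
    using sf by (rule summable_ignore_initial_segment)
  show "0 \<le> (\<Sum>k. ?f k) - (\<Sum>k=1..M. c (k - 1) / real k ^ 2)"
    unfolding eq by (rule suminf_nonneg[OF sf']) (simp add: c)
  have "(\<lambda>k. 1 / real (k + M)) \<longlonglongrightarrow> 0"
    using LIMSEQ_ignore_initial_segment[OF lim_1_over_n, of M] by simp
  from telescope_sums'[OF this]
  have tel: "(\<lambda>k. 1 / real (k + M) - 1 / real (Suc k + M)) sums (1 / real M)" by simp
  have "(\<Sum>k. ?f (k + M)) \<le> (\<Sum>k. 1 / real (k + M) - 1 / real (Suc k + M))"
  proof (rule suminf_le[OF _ sf'])
    fix k
    have "?f (k + M) \<le> 1 / real (Suc (k + M)) ^ 2"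
      by (intro divide_right_mono c) auto
    also have "\<dots> \<le> 1 / (real (k + M) * real (Suc (k + M)))"
      using M by (intro divide_left_mono) (auto simp: power2_eq_square intro!: mult_right_mono)
    also have "\<dots> = 1 / real (k + M) - 1 / real (Suc k + M)"
      using M by (simp add: field_simps)
    finally show "?f (k + M) \<le> 1 / real (k + M) - 1 / real (Suc k + M)" .
  qed (use tel in \<open>simp add: sums_iff\<close>)
  also have "\<dots> = 1 / real M" using tel by (simp add: sums_iff)
  finally show "(\<Sum>k. ?f k) - (\<Sum>k=1..M. c (k - 1) / real k ^ 2) \<le> 1 / real M" 
    unfolding eq .
qed

lemma real_div_bounds:
  fixes n k :: nat
  assumes "1 \<le> k" "k \<le> n"
  shows "real (n div k) \<le> real n / real k" "real n / real k < real (n div k) + 1" 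
    "1 \<le> real (n div k)"
proof -
  show "real (n div k) \<le> real n / real k" by (rule of_nat_div_le_of_nat)
  have "n < k * (n div k) + k"
    using assms mod_less_divisor[of k n] mult_div_mod_eq[of k n] by linarith
  then have "real n < real (k * (n div k) + k)" by (simp only: of_nat_less_iff)
  then show "real n / real k < real (n div k) + 1"
    using assms by (simp add: field_simps)
  have "n div k \<noteq> 0" using assms by (simp add: div_eq_0_iff)
  then show "1 \<le> real (n div k)" by linarith
qed

text \<open>Truncating the convolution identity \<open>sum_moebius_inverse_squares\<close> at \<open>N\<close> makes the convergence
  of the Moebius series unnecessary.\<close>

lemma moebius_inverse_squares_estimate:
  assumes "N \<ge> 1"
  shows "\<bar>(\<Sum>d=1..N. moebius_mu d / real d ^ 2) - 6 / pi\<^sup>2\<bar> \<le> 2 * harm N / real N"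
proof -
  let ?M = "\<Sum>d=1..N. moebius_mu d / real d ^ 2" and ?z = "pi\<^sup>2 / 6"
  have z: "(\<Sum>k. 1 / real (Suc k) ^ 2) = ?z"
    using inverse_squares_sums by (simp add: sums_iff add.commute)
  have r: "\<bar>?z - (\<Sum>k=1..N div d. 1 / real k ^ 2)\<bar> \<le> 2 * real d / real N" if "d \<in> {1..N}" for d
  proof -
    note b = real_div_bounds[of d N]
    \<comment> \<open>With m = N div d \<ge> 1, N / d < m + 1 \<le> 2 * m, so the floor loses at
      most a factor 2.\<close>
    have half: "real N / (2 * real d) \<le> real (N div d)" using b that by simp
    have "N div d > 0" using b that by simp
    from weighted_inverse_squares_tail[of "\<lambda>_. 1", OF _ _ this] z
    have "\<bar>?z - (\<Sum>k=1..N div d. 1 / real k ^ 2)\<bar> \<le> 1 / real (N div d)" by simp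
    also have "\<dots> \<le> 1 / (real N / (2 * real d))"
      using b that assms half by (intro divide_left_mono) auto
    finally show ?thesis by simp
  qed
  \<comment> \<open>The 1 is replaced by the truncated convolution, so that only tails of zeta(2)
    remain.\<close>
  have "?z * ?M - 1 = (\<Sum>d=1..N. moebius_mu d / real d ^ 2 * (?z - (\<Sum>k=1..N div d. 1 / real k ^ 2)))"
    using sum_moebius_inverse_squares[OF assms]
    by (simp add: right_diff_distrib sum_subtractf sum_distrib_left mult.commute)
  also have "\<bar>\<dots>\<bar> \<le> (\<Sum>d=1..N. 1 / real d ^ 2 * (2 * real d / real N))"
  proof (rule order.trans[OF sum_abs], rule sum_mono)
    fix d assume d: "d \<in> {1..N}"
    show "\<bar>moebius_mu d / real d ^ 2 * (?z - (\<Sum>k=1..N div d. 1 / real k ^ 2))\<bar>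
        \<le> 1 / real d ^ 2 * (2 * real d / real N)"
      unfolding abs_mult
      by (intro mult_mono r[OF d]) (auto simp: abs_moebius_le_1 intro!: divide_right_mono)
  qed
  also have "\<dots> = 2 * harm N / real N"
    by (simp add: harm_def sum_distrib_left sum_divide_distrib power2_eq_square field_simps)
  finally have *: "\<bar>?z * ?M - 1\<bar> \<le> 2 * harm N / real N" .
  \<comment> \<open>Since zeta(2) \<ge> 1, dividing the estimate by it does not increase the
    error.\<close>
  have "3 ^ 2 \<le> pi ^ 2" using pi_gt3 by (intro power_mono) auto
  then have z1: "1 \<le> ?z" by simp
  have "\<bar>?M - 6 / pi\<^sup>2\<bar> \<le> ?z * \<bar>?M - 6 / pi\<^sup>2\<bar>" 
    using mult_right_mono[OF z1, of "\<bar>?M - 6 / pi\<^sup>2\<bar>"] by simp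
  also have "\<dots> = \<bar>?z * (?M - 6 / pi\<^sup>2)\<bar>" by (simp add: abs_mult)
  also have "?z * (?M - 6 / pi\<^sup>2) = ?z * ?M - 1" by (simp add: field_simps)
  finally show ?thesis using * by linarith
qed

text \<open>Removing the floors costs N / (2 * d) for each d, in total N * harm N / 2; replacing the
  Moebius partial sum by 6 / pi^2 costs another N * harm N.\<close>

lemma totient_sum_estimate:
  assumes "N \<ge> 1"
  shows "\<bar>totient_sum N - 3 / pi\<^sup>2 * real N ^ 2\<bar> \<le> 3 / 2 * real N * harm N"
proof -
  let ?M = "\<Sum>d=1..N. moebius_mu d / real d ^ 2"
  have "totient_sum N - real N ^ 2 / 2 * ?M =
     (\<Sum>d=1..N. moebius_mu d * (real (N div d) * (real (N div d) + 1) / 2 - (real N / real d) ^ 2 / 2))"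
    by (simp add: totient_sum_moebius[OF assms] right_diff_distrib sum_subtractf sum_distrib_left power_divide
         mult.commute)
  also have "\<bar>\<dots>\<bar> \<le> (\<Sum>d=1..N. 1 * (real N / real d / 2))"
  proof (rule order.trans[OF sum_abs], rule sum_mono)
    fix d assume d: "d \<in> {1..N}"
    define x m where "x = real N / real d" and "m = real (N div d)"
    have b: "m \<le> x" "x < m + 1" "1 \<le> m"
      using real_div_bounds[of d N] d by (auto simp: x_def m_def)
    \<comment> \<open>Since x - 1 < m \<le> x, the product m * (m + 1) lies between (x - 1) * x and
      x * (x + 1), so it differs from x^2 by at most x.\<close>
    have "m * (m + 1) \<le> x * (x + 1)" using b by (intro mult_mono) auto
    moreover have "(x - 1) * x \<le> m * (m + 1)" using b by (intro mult_mono) auto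
    ultimately have "\<bar>m * (m + 1) / 2 - x ^ 2 / 2\<bar> \<le> x / 2"
      unfolding abs_le_iff power2_eq_square by (simp add: algebra_simps)
    then show "\<bar>moebius_mu d * (real (N div d) * (real (N div d) + 1) / 2 - (real N / real d) ^ 2 / 2)\<bar>
      \<le> 1 * (real N / real d / 2)"
      unfolding abs_mult by (intro mult_mono abs_moebius_le_1) (auto simp: x_def m_def)
  qed
  also have "\<dots> = real N * harm N / 2"
    by (simp add: harm_def sum_distrib_left sum_divide_distrib field_simps)
  finally have 1: "\<bar>totient_sum N - real N ^ 2 / 2 * ?M\<bar> \<le> real N * harm N / 2" .
  have "\<bar>real N ^ 2 / 2 * ?M - 3 / pi\<^sup>2 * real N ^ 2\<bar> = \<bar>real N ^ 2 / 2 * (?M - 6 / pi\<^sup>2)\<bar>"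
    by (simp add: algebra_simps)
  also have "\<dots> = real N ^ 2 / 2 * \<bar>?M - 6 / pi\<^sup>2\<bar>" by (simp add: abs_mult)
  also have "\<dots> \<le> real N ^ 2 / 2 * (2 * harm N / real N)"
    by (intro mult_left_mono moebius_inverse_squares_estimate[OF assms]) auto
  also have "\<dots> = real N * harm N"
    using assms by (simp add: field_simps power2_eq_square)
  finally show ?thesis using 1 by linarith
qed

subsection \<open>The degree of the least common multiple\<close>

text \<open>Over the complex numbers \<open>qint k\<close> splits into distinct linear factors for k
  > 0, so degrees can be read off by counting roots.\<close>

abbreviation cpoly :: "rat poly \<Rightarrow> complex poly" where
  "cpoly \<equiv> map_poly of_rat"

lemma cpoly_mult: "cpoly (p * q) = cpoly p * cpoly q"
  by (rule poly_eqI) (simp add: coeff_map_poly coeff_mult of_rat_sum of_rat_mult)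

lemma cpoly_prod: "finite S \<Longrightarrow> cpoly (prod f S) = (\<Prod>x\<in>S. cpoly (f x))"
  by (induction S rule: finite_induct) (simp_all add: cpoly_mult)

lemma degree_cpoly: "degree (cpoly p) = degree p"
  by (rule degree_map_poly) simp

lemma cpoly_eq_0_iff: "cpoly p = 0 \<longleftrightarrow> p = 0"
  by (auto simp: poly_eq_iff coeff_map_poly)

section \<open>Roots and divisibility of the q-integers\<close>

lemma coeff_qint: "coeff (qint k) i = (if i < k then 1 else 0)"
  by (simp add: qint_def coeff_sum)

lemma poly_cpoly_qint: "poly (cpoly (qint k)) z = (\<Sum>i<k. z ^ i)"
proof -
  have "cpoly (qint k) = (\<Sum>i<k. monom 1 i)"
    by (rule poly_eqI) (simp add: coeff_map_poly coeff_qint coeff_sum)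
  then show ?thesis by (simp add: poly_sum poly_monom)
qed

lemma qint_eq_0_iff: "qint k = 0 \<longleftrightarrow> k = 0"
  by (auto simp: poly_eq_iff coeff_qint)

lemma degree_qint: "degree (qint k) = k - 1"
proof (cases k)
  case (Suc m)
  have "degree (qint k) \<le> m" by (rule degree_le) (simp add: coeff_qint Suc)
  moreover have "m \<le> degree (qint k)" by (rule le_degree) (simp add: coeff_qint Suc)
  ultimately show ?thesis using Suc by simp
qed (simp add: qint_def)

lemma roots_cpoly_qint:
  assumes "k > 0"
  shows "{z. poly (cpoly (qint k)) z = 0} = {z. z ^ k = 1} - {1}"
proof -
  have "(\<Sum>i<k. z ^ i) = 0 \<longleftrightarrow> z ^ k = 1 \<and> z \<noteq> 1" for z :: complex
  proof (cases "z = 1")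
    case False
    then show ?thesis by (simp add: geometric_sum)
  qed (use assms in simp)
  then show ?thesis by (auto simp: poly_cpoly_qint)
qed

text \<open>There are k roots of unity of exponent k, and 1 is removed. As this count equals the
  degree, all roots are simple.\<close>

lemma card_roots_cpoly_qint:
  assumes "k > 0"
  shows "card {z. poly (cpoly (qint k)) z = 0} = k - 1"
  using assms
  by (simp add: roots_cpoly_qint card_Diff_singleton card_roots_unity_eq finite_roots_unity Suc_le_eq)

text \<open>Multiplication by q - 1 turns \<open>qint k\<close> into q^k - 1, and y - 1 divides y^m
  - 1 for y = q^a; the factor q - 1 is then cancelled.\<close>

lemma qint_dvd_qint:
  assumes "a dvd N"
  shows "qint a dvd qint N"
proof (cases "a = 0")
  case False
  obtain m where m: "N = a * m" using assms by auto
  have geo: "qint k * [:-1, 1:] = monom 1 k - 1" for k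
  proof (rule poly_eqI)
    fix i
    show "coeff (qint k * [:-1, 1:]) i = coeff (monom 1 k - 1) i"
      by (cases i) (auto simp: coeff_qint coeff_pCons)
  qed
  have "monom 1 N - 1 = (monom 1 a ^ m - 1 :: rat poly)"
    by (simp add: m monom_power)
  also have "(monom 1 a - 1) dvd (monom 1 a ^ m - 1 :: rat poly)"
    by (simp add: power_diff_1_eq)
  finally have "qint a * [:-1, 1:] dvd qint N * [:-1, 1:]" by (simp only: geo)
  then show ?thesis by (subst (asm) dvd_times_right_cancel_iff) auto
qed (use assms in auto)

text \<open>The lcm divides \<open>qint (fact n)\<close>, whose roots are simple, so its degree is
  its number of roots. These roots are the union of those of the \<open>qint a\<close>, because the
  lcm divides their product and each of them divides the lcm.\<close>

lemma lcm_deg_eq_card_roots: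
  assumes A: "A \<subseteq> {1..n}"
  shows "lcm_deg A = card {z::complex. z \<noteq> 1 \<and> (\<exists>a\<in>A. z ^ a = 1)}"
proof -
  define N :: nat where "N = fact n"
  define L where "L = Lcm (qint ` A)"
  define R where "R p = {z. poly (cpoly p) z = 0}" for p
  have fin: "finite A" using A finite_subset by auto
  have N0: "N > 0" by (simp add: N_def)
  have "L dvd qint N"
    unfolding L_def N_def by (rule Lcm_least) (use A in \<open>auto intro!: qint_dvd_qint dvd_fact\<close>)
  then obtain Q where Q: "qint N = L * Q" by auto
  have nz: "L \<noteq> 0" "Q \<noteq> 0" using Q N0 qint_eq_0_iff[of N] by auto
  have finR: "finite (R p)" if "p \<noteq> 0" for p
    unfolding R_def using that by (intro poly_roots_finite) (simp add: cpoly_eq_0_iff)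
  have Rmult: "R (p * q) = R p \<union> R q" for p q
    by (auto simp: R_def cpoly_mult)
  have cardR: "card (R p) \<le> degree p" if "p \<noteq> 0" for p
    using card_poly_roots_bound[of "cpoly p"] that by (simp add: R_def cpoly_eq_0_iff degree_cpoly)
  \<comment> \<open>Both factors have at most as many roots as their degree; since their product has
      \<open>N - 1\<close> distinct roots, both bounds are attained.\<close>
  have "degree L + degree Q = N - 1"
    using nz degree_qint[of N] by (simp add: Q degree_mult_eq)
  also have "\<dots> = card (R (qint N))"
    using N0 by (simp add: R_def card_roots_cpoly_qint)
  also have "\<dots> \<le> card (R L) + card (R Q)"
    unfolding Q Rmult by (rule card_Un_le)
  finally have "degree L = card (R L)" using cardR[OF nz(1)] cardR[OF nz(2)] by linarith
  also have "R L = (\<Union>a\<in>A. R (qint a))"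
  proof
    have "L dvd (\<Prod>a\<in>A. qint a)"
      unfolding L_def using fin by (intro Lcm_least) auto
    then obtain P where "(\<Prod>a\<in>A. qint a) = L * P" by auto
    then have "R L \<subseteq> R (\<Prod>a\<in>A. qint a)" by (simp add: Rmult)
    also have "\<dots> = (\<Union>a\<in>A. R (qint a))"
      using fin by (auto simp: R_def cpoly_prod poly_prod)
    finally show "R L \<subseteq> (\<Union>a\<in>A. R (qint a))" .
    show "(\<Union>a\<in>A. R (qint a)) \<subseteq> R L"
    proof
      fix z assume "z \<in> (\<Union>a\<in>A. R (qint a))"
      then obtain a where a: "a \<in> A" "z \<in> R (qint a)" by auto
      then have "qint a dvd L" unfolding L_def by (intro dvd_Lcm) auto
      then obtain P where "L = qint a * P" by auto
      then show "z \<in> R L" using a by (simp add: Rmult)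
    qed
  qed
  also have "\<dots> = {z. z \<noteq> 1 \<and> (\<exists>a\<in>A. z ^ a = 1)}"
  proof -
    have "R (qint a) = {z. z ^ a = 1} - {1}" if "a \<in> A" for a
      unfolding R_def using A that by (intro roots_cpoly_qint) auto
    then show ?thesis by auto
  qed
  finally show ?thesis by (simp add: lcm_deg_def L_def)
qed

section \<open>Roots of unity sorted by exact order\<close>

lemma cis_root_power_eq_1_iff:
  assumes "N > 0"
  shows "cis (2 * pi * real j / real N) ^ a = 1 \<longleftrightarrow> N dvd j * a"
proof -
  have "cis (2 * pi * real j / real N) ^ a = exp (2 * of_real pi * \<i> * of_nat (j * a) / of_nat N)"
    by (subst Complex.DeMoivre, subst cis_conv_exp) (simp add: field_simps)
  then show ?thesis
    using complex_root_unity_eq_1[of N "j * a"] assms by simp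
qed

text \<open>After division by gcd j N the cofactors are coprime. Thus the j-th root of unity of
  exponent N has exact order N div gcd j N.\<close>

lemma dvd_mult_iff_div_gcd_dvd:
  fixes N j a :: nat
  assumes "N > 0"
  shows "N dvd j * a \<longleftrightarrow> N div gcd j N dvd a"
proof -
  define g where "g = gcd j N"
  obtain j' N' where j': "j = j' * g" "N = N' * g" "coprime j' N'"
    using assms gcd_coprime_exists[of j N] unfolding g_def by auto
  have "g > 0" using assms by (simp add: g_def)
  have "N dvd j * a \<longleftrightarrow> N' * g dvd (j' * a) * g" using j' by (simp add: mult_ac)
  also have "\<dots> \<longleftrightarrow> N' dvd j' * a" using \<open>g > 0\<close> by simp
  also have "\<dots> \<longleftrightarrow> N' dvd a"
    using j' by (intro coprime_dvd_mult_right_iff) (simp add: coprime_commute)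
  also have "N' = N div gcd j N" using j'(2) \<open>g > 0\<close> by (metis g_def nonzero_mult_div_cancel_right not_gr0)
  finally show ?thesis .
qed

text \<open>All roots in question have exponent N = n! and are sorted by their exact order d. Such a
  root satisfies z^a = 1 iff d divides a, and there are \<open>totient d\<close> of them. The
  excluded root 1 is the case d = 1.\<close>

lemma lcm_deg_eq_sum_totient:
  assumes A: "A \<subseteq> {1..n}"
  shows "lcm_deg A = (\<Sum>d | d \<in> {2..n} \<and> (\<exists>a\<in>A. d dvd a). totient d)"
proof -
  define N :: nat where "N = fact n"
  define D where "D = {d. d \<in> {2..n} \<and> (\<exists>a\<in>A. d dvd a)}"
  \<comment> \<open>The indices of the roots of order d. The interval has the form required by
    \<open>card_gcd_eq_totient\<close>; its endpoint j = N is never attained for d in D, because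
    then N div d < N.\<close>
  define J where "J d = {j\<in>{0<..N}. gcd j N = N div d}" for d
  have N0: "N > 0" by (simp add: N_def)
  have N_dvd: "d dvd N" if "d \<in> D" for d
    using that by (auto simp: D_def N_def intro!: dvd_fact)
  have div_div: "N div (N div d) = d" if "d \<in> D" for d
    using N_dvd[OF that] N0 by (auto elim!: dvdE)
  let ?c = "\<lambda>j. cis (2 * pi * real j / real N)"
  have bij: "bij_betw ?c {..<N} {z. z ^ N = 1}"
    by (rule Complex.bij_betw_roots_unity[OF N0])
  have one: "?c j \<noteq> 1 \<longleftrightarrow> j \<noteq> 0" if "j < N" for j
    using cis_root_power_eq_1_iff[OF N0, of j 1] that by (cases "j = 0") (auto dest: nat_dvd_not_less)
  have order: "?c j ^ a = 1 \<longleftrightarrow> N div gcd j N dvd a" for j a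
    unfolding cis_root_power_eq_1_iff[OF N0] by (rule dvd_mult_iff_div_gcd_dvd[OF N0])
  have "{z::complex. z \<noteq> 1 \<and> (\<exists>a\<in>A. z ^ a = 1)} = ?c ` (\<Union>d\<in>D. J d)"
  proof safe
    fix z :: complex and a assume z: "z \<noteq> 1" and a: "a \<in> A" "z ^ a = 1"
    have "a dvd N" using a A by (auto simp: N_def intro!: dvd_fact)
    then have "z ^ N = 1" using a by (auto simp: power_mult elim!: dvdE)
    then obtain j where j: "j < N" "z = ?c j"
      using bij by (auto simp: bij_betw_def)
    define d where "d = N div gcd j N"
    have j0: "j \<noteq> 0" using one j z by simp
    have dg: "d * gcd j N = N" by (simp add: d_def)
    have da: "d dvd a" using a(2) order[of j a] j by (simp add: d_def)
    have "gcd j N < N" using j j0 by (meson gcd_le1_nat le_less_trans)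
    with dg have "d \<noteq> 1" "d \<noteq> 0" using N0 by (metis mult_1 less_irrefl, metis mult_0 less_irrefl)
    moreover have "d \<le> n" using da a A by (force dest: dvd_imp_le)
    ultimately have "d \<in> D" using da a by (auto simp: D_def)
    moreover have "d * gcd j N div d = gcd j N" using \<open>d \<noteq> 0\<close> by simp
    then have "j \<in> J d" using j j0 by (simp add: J_def dg)
    ultimately show "z \<in> ?c ` (\<Union>d\<in>D. J d)" using j by auto
  next
    fix d j assume d: "d \<in> D" and j: "j \<in> J d"
    have "N div d < N" using d N0 by (intro div_less_dividend) (auto simp: D_def)
    then have "j \<noteq> N" using j by (auto simp: J_def)
    then have jN: "0 < j" "j < N" using j by (auto simp: J_def)
    then show False if "?c j = 1" using one that by auto
    obtain a where a: "a \<in> A" "d dvd a" using d by (auto simp: D_def)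
    have "N div gcd j N = d"
      using j div_div[OF d] by (simp add: J_def)
    then show "\<exists>a\<in>A. ?c j ^ a = 1"
      using a order by auto
  qed
  moreover have "inj_on ?c (\<Union>d\<in>D. J d)"
  proof (rule inj_on_subset)
    show "inj_on ?c {..<N}" using bij by (simp add: bij_betw_def)
    show "(\<Union>d\<in>D. J d) \<subseteq> {..<N}"
    proof safe
      fix d j assume d: "d \<in> D" and j: "j \<in> J d"
      have "N div d < N" using d N0 by (intro div_less_dividend) (auto simp: D_def)
      then have "j \<noteq> N" using j by (auto simp: J_def)
      then show "j < N" using j by (auto simp: J_def)
    qed
  qed
  ultimately have "lcm_deg A = card (\<Union>d\<in>D. J d)"
    by (simp add: lcm_deg_eq_card_roots[OF A] card_image)
  also have "\<dots> = (\<Sum>d\<in>D. card (J d))"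
  proof (rule card_UN_disjoint)
    show "finite D" by (rule finite_subset[of _ "{2..n}"]) (auto simp: D_def)
    show "\<forall>i\<in>D. \<forall>j\<in>D. i \<noteq> j \<longrightarrow> J i \<inter> J j = {}"
    proof (intro ballI impI)
      fix i j assume "i \<in> D" "j \<in> D" "i \<noteq> j"
      then have "N div i \<noteq> N div j" using div_div by metis
      then show "J i \<inter> J j = {}" by (auto simp: J_def)
    qed
  qed (auto simp: J_def)
  also have "\<dots> = (\<Sum>d\<in>D. totient d)"
  proof (rule sum.cong[OF refl])
    fix d assume d: "d \<in> D"
    have "card (J d) = totient (N div (N div d))"
      unfolding J_def using N0 N_dvd[OF d] by (intro card_gcd_eq_totient) auto
    also have "N div (N div d) = d" by (rule div_div[OF d])
    finally show "card (J d) = totient d" .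
  qed
  finally show ?thesis by (simp add: D_def)
qed

subsection \<open>The expected degree\<close>

text \<open>Total probability, by expanding the product over S of the factors \<alpha> + (1 -
  \<alpha>).\<close>

lemma sum_Pow_weights:
  fixes \<alpha> :: real
  assumes "finite S"
  shows "(\<Sum>A\<in>Pow S. \<alpha> ^ card A * (1 - \<alpha>) ^ (card S - card A)) = 1"
proof -
  have "(\<Sum>A\<in>Pow S. \<alpha> ^ card A * (1 - \<alpha>) ^ (card S - card A))
      = (\<Sum>A\<in>Pow S. (\<Prod>x\<in>A. \<alpha>) * (\<Prod>x\<in>S - A. 1 - \<alpha>))"
    using assms by (intro sum.cong) (auto simp: card_Diff_subset finite_subset)
  also have "\<dots> = 1" by (subst prod_add[OF assms, symmetric]) simp
  finally show ?thesis .
qed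

lemma atLeastAtMost_div_eq:
  fixes n d :: nat
  assumes "d > 0"
  shows "{1..n div d} = {k\<in>{1..n}. d * k \<le> n}"
proof -
  have "k \<le> n" if "d * k \<le> n" for k
  proof -
    have "1 * k \<le> d * k" using assms by (intro mult_right_mono) auto
    then show ?thesis using that by linarith
  qed
  then show ?thesis
    using assms by (auto simp: less_eq_div_iff_mult_less_eq mult.commute)
qed

lemma card_multiples:
  assumes "d > 0"
  shows "card {a\<in>{1..n}. d dvd a} = n div d"
proof -
  have "{a\<in>{1..n}. d dvd a} = (\<lambda>k. d * k) ` {1..n div d}"
  proof (intro equalityI subsetI)
    fix a assume "a \<in> {a\<in>{1..n}. d dvd a}"
    then obtain k where k: "a = d * k" "1 \<le> d * k" "d * k \<le> n" by auto
    have "k \<noteq> 0" using k(2) by (intro notI) simp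
    then have "k \<in> {1..n div d}"
      using k assms by (simp add: less_eq_div_iff_mult_less_eq mult.commute)
    then show "a \<in> (\<lambda>k. d * k) ` {1..n div d}" using k by blast
  next
    fix a assume "a \<in> (\<lambda>k. d * k) ` {1..n div d}"
    then obtain k where k: "a = d * k" "k \<in> {1..n div d}" by blast
    then have "d * k \<le> n" unfolding atLeastAtMost_div_eq[OF assms] by simp
    then show "a \<in> {a\<in>{1..n}. d dvd a}" using k assms by simp
  qed
  then show ?thesis using assms by (simp add: card_image inj_on_def)
qed

text \<open>The complementary event is that A avoids the n div d multiples of d. Its weights split
  into (1 - \<alpha>)^(n div d) and the weights of the model on the remaining elements, which sum to
  1.\<close>

lemma expect_B_multiple:
  assumes "d > 0"
  shows "expect_B n \<alpha> (\<lambda>A. if \<exists>a\<in>A. d dvd a then 1 else 0) = 1 - (1 - \<alpha>) ^ (n div d)"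
proof -
  define T where "T = {a\<in>{1..n}. d dvd a}"
  define w where "w A = \<alpha> ^ card A * (1 - \<alpha>) ^ (n - card A)" for A :: "nat set"
  have T: "T \<subseteq> {1..n}" "finite T" "card T = n div d"
    using card_multiples[OF assms] by (auto simp: T_def)
  have "expect_B n \<alpha> (\<lambda>A. if \<exists>a\<in>A. d dvd a then 1 else 0)
     = (\<Sum>A\<in>Pow {1..n}. w A - (if A \<in> Pow ({1..n} - T) then w A else 0))"
    unfolding expect_B_def w_def by (intro sum.cong) (auto simp: T_def)
  also have "\<dots> = (\<Sum>A\<in>Pow {1..n}. w A) - (\<Sum>A\<in>Pow {1..n} \<inter> Pow ({1..n} - T). w A)"
    by (simp add: sum_subtractf sum.inter_restrict)
  also have "(\<Sum>A\<in>Pow {1..n}. w A) = 1"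
    using sum_Pow_weights[of "{1..n}" \<alpha>] by (simp add: w_def)
  also have "Pow {1..n} \<inter> Pow ({1..n} - T) = Pow ({1..n} - T)" by auto
  also have "(\<Sum>A\<in>Pow ({1..n} - T). w A) = (\<Sum>A\<in>Pow ({1..n} - T).
      (1 - \<alpha>) ^ (n div d) * (\<alpha> ^ card A * (1 - \<alpha>) ^ (card ({1..n} - T) - card A)))"
  proof (rule sum.cong[OF refl])
    fix A assume "A \<in> Pow ({1..n} - T)"
    then have "card A \<le> card ({1..n} - T)" by (intro card_mono) auto
    moreover have c: "card ({1..n} - T) = n - n div d" using T by (simp add: card_Diff_subset)
    ultimately have "n - card A = n div d + (card ({1..n} - T) - card A)"
      using div_le_dividend[of n d] by linarith
    then show "w A = (1 - \<alpha>) ^ (n div d) * (\<alpha> ^ card A * (1 - \<alpha>) ^ (card ({1..n} - T) - card A))"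
      by (simp add: w_def power_add)
  qed
  also have "\<dots> = (1 - \<alpha>) ^ (n div d)"
    by (simp only: sum_distrib_left[symmetric]) (simp add: sum_Pow_weights)
  finally show ?thesis .
qed

text \<open>Linearity of expectation, applied to the indicators of the events that d divides some
  element of A.\<close>

lemma expect_lcm_deg:
  "expect_B n \<alpha> (\<lambda>A. real (lcm_deg A)) = (\<Sum>d=2..n. real (totient d) * (1 - (1 - \<alpha>) ^ (n div d)))"
proof -
  have "expect_B n \<alpha> (\<lambda>A. real (lcm_deg A))
     = (\<Sum>A\<in>Pow {1..n}. \<Sum>d=2..n. \<alpha> ^ card A * (1 - \<alpha>) ^ (n - card A) *
          (real (totient d) * (if \<exists>a\<in>A. d dvd a then 1 else 0)))"
    unfolding expect_B_def
  proof (rule sum.cong[OF refl])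
    fix A assume "A \<in> Pow {1..n}"
    then have "lcm_deg A = (\<Sum>d | d \<in> {2..n} \<and> (\<exists>a\<in>A. d dvd a). totient d)"
      by (intro lcm_deg_eq_sum_totient) auto
    also have "\<dots> = (\<Sum>d=2..n. if \<exists>a\<in>A. d dvd a then totient d else 0)"
      by (rule sum.inter_filter) simp
    finally have "real (lcm_deg A) = (\<Sum>d=2..n. real (totient d) * (if \<exists>a\<in>A. d dvd a then 1 else 0))"
      by (auto intro!: sum.cong)
    then show "\<alpha> ^ card A * (1 - \<alpha>) ^ (n - card A) * real (lcm_deg A)
       = (\<Sum>d=2..n. \<alpha> ^ card A * (1 - \<alpha>) ^ (n - card A) *
          (real (totient d) * (if \<exists>a\<in>A. d dvd a then 1 else 0)))"
      by (simp add: sum_distrib_left)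
  qed
  also have "\<dots> = (\<Sum>d=2..n. real (totient d) * expect_B n \<alpha> (\<lambda>A. if \<exists>a\<in>A. d dvd a then 1 else 0))"
    by (subst sum.swap) (simp add: expect_B_def sum_distrib_left mult_ac)
  also have "\<dots> = (\<Sum>d=2..n. real (totient d) * (1 - (1 - \<alpha>) ^ (n div d)))"
    by (intro sum.cong) (auto simp: expect_B_multiple)
  finally show ?thesis .
qed

text \<open>A geometric sum with \<alpha> multiplied out, which also covers \<alpha> = 0. It is the
  source of the factor \<alpha> in the error bound.\<close>

lemma one_minus_power_eq: 
  "1 - (1 - \<alpha>) ^ m = (\<alpha>::real) * (\<Sum>k=1..m. (1 - \<alpha>) ^ (k - 1))"
  by (induction m) (auto simp: algebra_simps)

text \<open>After the geometric expansion the sum runs over pairs with d * k \<le> n, and summing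
  over d first gives \<open>totient_sum (n div k)\<close>. The subtracted term is the summand d = 1,
  absent from the expectation.\<close>

lemma expect_lcm_deg_totient_sum:
  assumes "n \<ge> 1"
  shows "expect_B n \<alpha> (\<lambda>A. real (lcm_deg A))
    = \<alpha> * (\<Sum>k=1..n. (1 - \<alpha>) ^ (k - 1) * totient_sum (n div k)) - (1 - (1 - \<alpha>) ^ n)"
proof -
  have "(\<Sum>d=1..n. real (totient d) * (1 - (1 - \<alpha>) ^ (n div d)))
     = (\<Sum>d=1..n. \<Sum>k=1..n div d. \<alpha> * ((1 - \<alpha>) ^ (k - 1) * real (totient d)))"
    by (simp only: one_minus_power_eq sum_distrib_left) (simp add: mult_ac)
  also have "\<dots> = (\<Sum>d=1..n. \<Sum>k | k \<in> {1..n} \<and> d * k \<le> n. \<alpha> * ((1 - \<alpha>) ^ (k - 1) * real (totient d)))"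
    by (intro sum.cong atLeastAtMost_div_eq refl) auto
  also have "\<dots> = (\<Sum>k=1..n. \<Sum>d | d \<in> {1..n} \<and> d * k \<le> n. \<alpha> * ((1 - \<alpha>) ^ (k - 1) * real (totient d)))"
    by (rule sum.swap_restrict) auto
  also have "\<dots> = (\<Sum>k=1..n. \<Sum>d=1..n div k. \<alpha> * ((1 - \<alpha>) ^ (k - 1) * real (totient d)))"
    by (intro sum.cong refl) (subst atLeastAtMost_div_eq, auto simp: mult.commute)
  also have "\<dots> = \<alpha> * (\<Sum>k=1..n. (1 - \<alpha>) ^ (k - 1) * totient_sum (n div k))"
    by (simp add: totient_sum_def sum_distrib_left)
  finally have "\<alpha> * (\<Sum>k=1..n. (1 - \<alpha>) ^ (k - 1) * totient_sum (n div k))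
      = (\<Sum>d=1..n. real (totient d) * (1 - (1 - \<alpha>) ^ (n div d)))" ..
  also have "\<dots> = (1 - (1 - \<alpha>) ^ n) + (\<Sum>d=2..n. real (totient d) * (1 - (1 - \<alpha>) ^ (n div d)))"
    using assms by (simp add: sum.atLeast_Suc_atMost numeral_2_eq_2)
  finally show ?thesis by (simp add: expect_lcm_deg)
qed

subsection \<open>Comparison with the main term\<close>

text \<open>One factor 1 - \<alpha> is taken out of the dilogarithm. At \<alpha> = 1 only the term k
  = 0 survives, with 0^0 = 1, which agrees with the separate case in
  \<open>lcm_factor\<close>.\<close>

lemma lcm_factor_eq_suminf:
  assumes "0 \<le> \<alpha>" "\<alpha> \<le> 1"
  shows "lcm_factor \<alpha> = \<alpha> * (\<Sum>k. (1 - \<alpha>) ^ k / real (Suc k) ^ 2)"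
proof (cases "\<alpha> = 1")
  case True
  have "(\<Sum>k. (1 - \<alpha>) ^ k / real (Suc k) ^ 2) = (\<Sum>k\<in>{0}. (1 - \<alpha>) ^ k / real (Suc k) ^ 2)"
    by (rule suminf_finite) (auto simp: True)
  then show ?thesis by (simp add: lcm_factor_def True)
next
  case False
  have "summable (\<lambda>k. (1 - \<alpha>) ^ k / real (Suc k) ^ 2)"
    using assms by (intro weighted_inverse_squares_tail(1)[where M = 1]) (auto simp: power_le_one)
  then have "Li2 (1 - \<alpha>) = (1 - \<alpha>) * (\<Sum>k. (1 - \<alpha>) ^ k / real (Suc k) ^ 2)"
    by (simp add: Li2_def suminf_mult[symmetric])
  then show ?thesis using False by (simp add: lcm_factor_def)
qed

text \<open>The first term of the series is 1 and the others are nonnegative. This bounds the main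
  term from below uniformly in \<alpha>.\<close>

lemma lcm_factor_ge:
  assumes "0 \<le> \<alpha>" "\<alpha> \<le> 1"
  shows "\<alpha> \<le> lcm_factor \<alpha>"
proof -
  have "0 \<le> (\<Sum>k. (1 - \<alpha>) ^ k / real (Suc k) ^ 2) - (\<Sum>k=1..1. (1 - \<alpha>) ^ (k - 1) / real k ^ 2)"
    using assms by (intro weighted_inverse_squares_tail(2)) (auto simp: power_le_one)
  then have "1 \<le> (\<Sum>k. (1 - \<alpha>) ^ k / real (Suc k) ^ 2)" by simp
  from mult_left_mono[OF this assms(1)] show ?thesis 
    by (simp add: lcm_factor_eq_suminf assms)
qed

lemma three_div_pi_squared_le: "3 / pi\<^sup>2 \<le> 1 / 3"
proof -
  have "3 ^ 2 \<le> pi ^ 2" using pi_gt3 by (intro power_mono) auto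
  then show ?thesis by (simp add: field_simps)
qed

text \<open>The totient estimate at the floor m of x = n / k contributes 3/2; passing from m^2 to
  x^2 costs at most 2/3 * x, which is absorbed into x * harm n. Using harm n in place of harm (n div
  k) makes the bound easy to sum over k.\<close>

lemma totient_sum_div_estimate:
  assumes "1 \<le> k" "k \<le> n"
  shows "\<bar>totient_sum (n div k) - 3 / pi\<^sup>2 * (real n / real k) ^ 2\<bar> \<le> 5 / 2 * (real n / real k) * harm n"
proof -
  define x m where "x = real n / real k" and "m = real (n div k)"
  have b: "m \<le> x" "x < m + 1" "1 \<le> m"
    using real_div_bounds[OF assms] by (auto simp: x_def m_def)
  have "harm 1 \<le> (harm n :: real)" using assms by (intro harm_mono) auto
  then have h1: "1 \<le> (harm n :: real)" by (simp add: harm_def)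
  have "\<bar>totient_sum (n div k) - 3 / pi\<^sup>2 * m ^ 2\<bar> \<le> 3 / 2 * m * harm (n div k)"
    unfolding m_def using b by (intro totient_sum_estimate) (auto simp: m_def)
  also have "\<dots> \<le> 3 / 2 * x * harm n"
    using b by (intro mult_mono harm_mono) (auto simp: harm_nonneg)
  finally have 1: "\<bar>totient_sum (n div k) - 3 / pi\<^sup>2 * m ^ 2\<bar> \<le> 3 / 2 * x * harm n" .
  have "m ^ 2 \<le> x ^ 2" using b by (intro power_mono) auto
  then have "0 \<le> 3 / pi\<^sup>2 * (x ^ 2 - m ^ 2)" by (intro mult_nonneg_nonneg) auto
  then have "\<bar>3 / pi\<^sup>2 * m ^ 2 - 3 / pi\<^sup>2 * x ^ 2\<bar> = 3 / pi\<^sup>2 * (x ^ 2 - m ^ 2)"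
    unfolding right_diff_distrib by linarith
  also have "\<dots> \<le> 1 / 3 * ((x - m) * (x + m))"
    using \<open>m ^ 2 \<le> x ^ 2\<close> three_div_pi_squared_le
    by (intro mult_mono) (auto simp: power2_eq_square algebra_simps)
  also have "\<dots> \<le> 1 / 3 * (1 * (2 * x))"
    using b by (intro mult_left_mono mult_mono) auto
  also have "\<dots> \<le> x * harm n" using mult_left_mono[OF h1, of x] b by simp
  finally have "\<bar>totient_sum (n div k) - 3 / pi\<^sup>2 * x ^ 2\<bar> \<le> 3 / 2 * x * harm n + x * harm n"
    using 1 by linarith
  then show ?thesis by (simp add: x_def mult_ac)
qed

text \<open>With \<alpha> factored out, three errors remain: 5/2 from the totient estimates, 1 from
  the tail of the dilogarithm series and 1 from the missing summand d = 1, each times n * (harm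
  n)^2.\<close>

lemma expect_lcm_deg_estimate:
  assumes n: "n \<ge> 1" and \<alpha>: "0 \<le> \<alpha>" "\<alpha> \<le> 1"
  shows "\<bar>expect_B n \<alpha> (\<lambda>A. real (lcm_deg A)) - main_term n \<alpha>\<bar> \<le> 9 / 2 * \<alpha> * real n * harm n ^ 2"
proof -
  define \<beta> where "\<beta> = 1 - \<alpha>"
  define P where "P = (\<Sum>k=1..n. \<beta> ^ (k - 1) / real k ^ 2)"
  define Q where "Q = (\<Sum>k. \<beta> ^ k / real (Suc k) ^ 2)"
  have \<beta>: "0 \<le> \<beta> ^ k" "\<beta> ^ k \<le> 1" for k
    using \<alpha> by (auto simp: \<beta>_def power_le_one)
  have "harm 1 \<le> (harm n :: real)" using n by (intro harm_mono) auto
  then have h1: "1 \<le> (harm n :: real)" by (simp add: harm_def)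
  then have h2: "1 \<le> (harm n :: real) ^ 2" by (rule one_le_power)
  have "(\<Sum>k=1..n. \<beta> ^ (k - 1) * totient_sum (n div k)) - 3 / pi\<^sup>2 * real n ^ 2 * P
     = (\<Sum>k=1..n. \<beta> ^ (k - 1) * (totient_sum (n div k) - 3 / pi\<^sup>2 * (real n / real k) ^ 2))"
    by (simp add: P_def sum_distrib_left right_diff_distrib sum_subtractf power_divide mult_ac)
  also have "\<bar>\<dots>\<bar> \<le> (\<Sum>k=1..n. 1 * (5 / 2 * (real n / real k) * harm n))"
  proof (rule order.trans[OF sum_abs], rule sum_mono)
    fix k assume "k \<in> {1..n}"
    then show "\<bar>\<beta> ^ (k - 1) * (totient_sum (n div k) - 3 / pi\<^sup>2 * (real n / real k) ^ 2)\<bar>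
       \<le> 1 * (5 / 2 * (real n / real k) * harm n)"
      unfolding abs_mult using \<beta>[of "k - 1"] by (intro mult_mono totient_sum_div_estimate) auto
  qed
  also have "\<dots> = 5 / 2 * real n * harm n * (\<Sum>k=1..n. inverse (real k))"
    by (simp add: sum_distrib_left field_simps)
  also have "\<dots> = 5 / 2 * real n * harm n ^ 2"
    by (simp add: harm_def power2_eq_square)
  finally have E1: "\<bar>(\<Sum>k=1..n. \<beta> ^ (k - 1) * totient_sum (n div k)) - 3 / pi\<^sup>2 * real n ^ 2 * P\<bar>
     \<le> 5 / 2 * real n * harm n ^ 2" .
  have "0 \<le> Q - P" "Q - P \<le> 1 / real n"
    unfolding P_def Q_def using n \<beta> by (intro weighted_inverse_squares_tail; simp)+
  have "3 / pi\<^sup>2 * real n ^ 2 * P - 3 / pi\<^sup>2 * real n ^ 2 * Q = - (3 / pi\<^sup>2 * real n ^ 2 * (Q - P))"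
    by (simp add: right_diff_distrib)
  then have "\<bar>3 / pi\<^sup>2 * real n ^ 2 * P - 3 / pi\<^sup>2 * real n ^ 2 * Q\<bar> = 3 / pi\<^sup>2 * real n ^ 2 * (Q - P)"
    using \<open>0 \<le> Q - P\<close> by simp
  also have "\<dots> \<le> 1 / 3 * real n ^ 2 * (1 / real n)"
    using \<open>0 \<le> Q - P\<close> \<open>Q - P \<le> 1 / real n\<close> three_div_pi_squared_le by (intro mult_mono) auto
  also have "\<dots> \<le> real n * 1" using n by (simp add: power2_eq_square)
  also have "\<dots> \<le> real n * harm n ^ 2" using h2 by (intro mult_left_mono) auto
  finally have E2: "\<bar>3 / pi\<^sup>2 * real n ^ 2 * P - 3 / pi\<^sup>2 * real n ^ 2 * Q\<bar> \<le> real n * harm n ^ 2" .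
  \<comment> \<open>By \<open>one_minus_power_eq\<close>, \<alpha> times this sum is the missing
    summand 1 - (1 - \<alpha>)^n.\<close>
  have "(\<Sum>k=1..n. \<beta> ^ (k - 1)) \<le> (\<Sum>k=1..n. 1)" by (intro sum_mono \<beta>)
  also have "\<dots> = real n * 1" by simp
  also have "\<dots> \<le> real n * harm n ^ 2" using h2 by (intro mult_left_mono) auto
  finally have E3: "\<bar>\<Sum>k=1..n. \<beta> ^ (k - 1)\<bar> \<le> real n * harm n ^ 2" 
    using \<beta> by (simp add: sum_nonneg)
  have "expect_B n \<alpha> (\<lambda>A. real (lcm_deg A)) - main_term n \<alpha>
     = \<alpha> * ((\<Sum>k=1..n. \<beta> ^ (k - 1) * totient_sum (n div k)) - 3 / pi\<^sup>2 * real n ^ 2 * Q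
            - (\<Sum>k=1..n. \<beta> ^ (k - 1)))"
    unfolding expect_lcm_deg_totient_sum[OF n] main_term_def lcm_factor_eq_suminf[OF \<alpha>]
      one_minus_power_eq Q_def \<beta>_def by (simp add: algebra_simps)
  also have "\<bar>\<dots>\<bar> \<le> \<alpha> * (9 / 2 * (real n * harm n ^ 2))"
  proof -
    have triangle: "\<bar>u - w - v\<bar> \<le> a + b + c"
      if "\<bar>u - x\<bar> \<le> a" "\<bar>x - w\<bar> \<le> b" "\<bar>v\<bar> \<le> c" for a b c u v w x :: real
      using that by linarith
    have "\<bar>(\<Sum>k=1..n. \<beta> ^ (k - 1) * totient_sum (n div k)) - 3 / pi\<^sup>2 * real n ^ 2 * Q
            - (\<Sum>k=1..n. \<beta> ^ (k - 1))\<bar>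
         \<le> 5 / 2 * real n * harm n ^ 2 + real n * harm n ^ 2 + real n * harm n ^ 2"
      by (rule triangle[OF E1 E2 E3])
    also have "\<dots> = 9 / 2 * (real n * harm n ^ 2)" by simp
    finally have "\<bar>(\<Sum>k=1..n. \<beta> ^ (k - 1) * totient_sum (n div k)) - 3 / pi\<^sup>2 * real n ^ 2 * Q
            - (\<Sum>k=1..n. \<beta> ^ (k - 1))\<bar> \<le> 9 / 2 * (real n * harm n ^ 2)" .
    from mult_left_mono[OF this \<alpha>(1)] show ?thesis
      unfolding abs_mult using \<alpha> by simp
  qed
  finally show ?thesis by (simp add: mult_ac)
qed

section \<open>Logarithmic bounds and uniform asymptotics\<close>

text \<open>The sequence harm n - ln n decreases from 1, and 1 \<le> 3/2 * ln n because ln 2 \<ge>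
  2/3.\<close>

lemma harm_le_3_ln:
  assumes "n \<ge> 2"
  shows "harm n \<le> 3 * ln (real n)"
proof -
  have "harm n - ln (real n) \<le> harm 1 - ln (real 1)"
    using assms by (intro euler_mascheroni_sequence_decreasing) auto
  moreover have "2 / 3 \<le> ln (real n)"
    using ln2_ge_two_thirds ln_le_cancel_iff[of 2 "real n"] assms by linarith
  ultimately show ?thesis by (simp add: harm_def)
qed

lemma expect_lcm_deg_ln_estimate:
  assumes "n \<ge> 2" "0 \<le> \<alpha>" "\<alpha> \<le> 1"
  shows "\<bar>expect_B n \<alpha> (\<lambda>A. real (lcm_deg A)) - main_term n \<alpha>\<bar> \<le> 41 * \<alpha> * real n * (ln (real n))\<^sup>2"
proof -
  have "\<bar>expect_B n \<alpha> (\<lambda>A. real (lcm_deg A)) - main_term n \<alpha>\<bar> \<le> 9 / 2 * \<alpha> * real n * harm n ^ 2"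
    using assms by (intro expect_lcm_deg_estimate) auto
  also have "\<dots> \<le> 9 / 2 * \<alpha> * real n * (3 * ln (real n)) ^ 2"
    using assms by (intro mult_left_mono power_mono harm_le_3_ln harm_nonneg) auto
  \<comment> \<open>The constant is 9/2 * 3^2 = 81/2, rounded up.\<close>
  also have "\<dots> \<le> 41 * (\<alpha> * real n * (ln (real n))\<^sup>2)"
    using assms by (simp add: power_mult_distrib mult_right_mono)
  finally show ?thesis by (simp add: mult_ac)
qed

theorem theorem1p2:
  shows "(\<exists>C>0. \<forall>n::nat. \<forall>\<alpha>::real. n \<ge> 2 \<longrightarrow> 0 \<le> \<alpha> \<longrightarrow> \<alpha> \<le> 1 \<longrightarrow>
            \<bar>expect_B n \<alpha> (\<lambda>A. real (lcm_deg A)) - main_term n \<alpha>\<bar>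
              \<le> C * \<alpha> * real n * (ln (real n))^2)
       \<and> (\<forall>\<epsilon>>0. \<exists>N::nat. \<forall>n\<ge>N. \<forall>\<alpha>::real. 0 < \<alpha> \<longrightarrow> \<alpha> \<le> 1 \<longrightarrow>
            \<bar>expect_B n \<alpha> (\<lambda>A. real (lcm_deg A)) / main_term n \<alpha> - 1\<bar> \<le> \<epsilon>)"
proof (intro conjI allI impI)
  show "\<exists>C>0. \<forall>n::nat. \<forall>\<alpha>::real. n \<ge> 2 \<longrightarrow> 0 \<le> \<alpha> \<longrightarrow> \<alpha> \<le> 1 \<longrightarrow>
            \<bar>expect_B n \<alpha> (\<lambda>A. real (lcm_deg A)) - main_term n \<alpha>\<bar>
              \<le> C * \<alpha> * real n * (ln (real n))^2"
    by (intro exI[of _ 41]) (auto intro: expect_lcm_deg_ln_estimate)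
next
  fix \<epsilon> :: real assume "\<epsilon> > 0"
  have "(\<lambda>n. 41 * pi\<^sup>2 / 3 * ((ln (real n))\<^sup>2 / real n)) \<longlonglongrightarrow> 0"
    by real_asymp
  from order_tendstoD(2)[OF this \<open>\<epsilon> > 0\<close>] obtain N where
    N: "\<And>n. n \<ge> N \<Longrightarrow> 41 * pi\<^sup>2 / 3 * ((ln (real n))\<^sup>2 / real n) < \<epsilon>"
    by (auto simp: eventually_sequentially)
  have "\<bar>expect_B n \<alpha> (\<lambda>A. real (lcm_deg A)) / main_term n \<alpha> - 1\<bar> \<le> \<epsilon>"
    if n: "n \<ge> max N 2" and \<alpha>: "0 < \<alpha>" "\<alpha> \<le> 1" for n \<alpha>
  proof -
    let ?E = "expect_B n \<alpha> (\<lambda>A. real (lcm_deg A))" and ?M = "main_term n \<alpha>"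
    have low: "3 / pi\<^sup>2 * \<alpha> * real n ^ 2 \<le> ?M"
      unfolding main_term_def using \<alpha> by (intro mult_right_mono mult_left_mono lcm_factor_ge) auto
    have pos: "0 < 3 / pi\<^sup>2 * \<alpha> * real n ^ 2" using \<alpha> n by simp
    have "\<bar>?E / ?M - 1\<bar> = \<bar>?E - ?M\<bar> / ?M"
      using low pos by (simp add: abs_div_pos diff_divide_distrib)
    \<comment> \<open>With the lower bound for the main term in the denominator, \<alpha> cancels,
      so the threshold depends on \<epsilon> only.\<close>
    also have "\<dots> \<le> (41 * \<alpha> * real n * (ln (real n))\<^sup>2) / (3 / pi\<^sup>2 * \<alpha> * real n ^ 2)"
      using low pos n \<alpha> by (intro frac_le expect_lcm_deg_ln_estimate) auto
    also have "\<dots> = 41 * pi\<^sup>2 / 3 * ((ln (real n))\<^sup>2 / real n)"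
      using \<alpha> n by (simp add: field_simps power2_eq_square)
    also have "\<dots> \<le> \<epsilon>" using N[of n] n by simp
    finally show ?thesis .
  qed
  then show "\<exists>N::nat. \<forall>n\<ge>N. \<forall>\<alpha>::real. 0 < \<alpha> \<longrightarrow> \<alpha> \<le> 1 \<longrightarrow>
            \<bar>expect_B n \<alpha> (\<lambda>A. real (lcm_deg A)) / main_term n \<alpha> - 1\<bar> \<le> \<epsilon>"
    by blast
qed

end
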